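(* For each $n$ let $2\le k=k_n\le n$, $\rho=\rho_n\in(0,1]$, and let $\mathcal C=\mathcal C_n$ be an arbitrary nonempty class of subsets of $\{1,\dots,n\}$ of size $k$. (i) Suppose $\rho k^2/n\to\infty$ as $n\to\infty$, and let $t_n$ be such that $t_n\to\infty$ and $t_n=o(\rho k^2/n)$. Then the test which rejects the null hypothesis if and only if $\left(\sum_{i=1}^nX_i\right)^2>n t_n$ has worst-case risk converging to zero under the general correlation model; that is, $$\mathbb P_0\Big\{\Big(\sum_{i=1}^n X_i\Big)^2>nt_n\Big\}+\sup_{S\in\mathcal C}\ \sup_{\mathbf A\in\mathcal M_S(\rho)}\mathbf P_{X\sim\mathcal N(0,\mathbf A)}\Big\{\Big(\sum_{i=1}^n X_i\Big)^2\le nt_n\Big\}\to0 .$$ (ii) Suppose instead that $\rho k^2/n\to0$. Then any test based on $\left(\sum_{i=1}^nX_i\right)^2$ is asymptotically powerless under the exact correlation model: for every sequence of tests $f_n$ such that $f_n(X)$ is a measurable $\{0,1\}$-valued function of $\left(\sum_{i=1}^nX_i\right)^2$, $$\liminf_{n\to\infty}\Big(\mathbb P_0\{f_n(X)=1\}+\max_{S\in\mathcal C}\mathbb P_S\{f_n(X)=0\}\Big)\ge1 .$$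
   Context: $\mathbb P_0$ is the law of $X\sim\mathcal N(0,\mathbf I)$ on $\mathbb R^n$. General correlation model: $\mathcal M_S(\rho)$ is the set of $n\times n$ covariance matrices $\mathbf A$ with $\mathbf A_{i,i}=1$, $\mathbf A_{i,j}\ge\rho$ for $i\ne j$ with $i,j\in S$, and $\mathbf A_{i,j}=0$ otherwise. Exact correlation model: $\mathbb P_S$ is the law of $X\sim\mathcal N(0,\mathbf A_S)$, where $(\mathbf A_S)_{i,i}=1$, $(\mathbf A_S)_{i,j}=\rho$ for $i\neq j$ with $i,j\in S$, and $(\mathbf A_S)_{i,j}=0$ otherwise. A test takes value $1$ when it rejects the null hypothesis. *)

theory Defs
  imports "HOL-Probability.Probability" "HOL-Library.Landau_Symbols"
begin

text \<open>
  Since the dimension \<open>n\<close> varies along a sequence, vectors of \<open>\<real>\<^sup>n\<close> are extensional functions on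
  \<open>{1..n}\<close> with the product Borel sigma-algebra, and an \<open>n \<times> n\<close> matrix is a function
  \<open>nat \<Rightarrow> nat \<Rightarrow> real\<close> of which only the entries with indices in \<open>{1..n}\<close> matter.
\<close>

definition covariance_matrix :: "nat \<Rightarrow> (nat \<Rightarrow> nat \<Rightarrow> real) \<Rightarrow> bool" where
  "covariance_matrix n A \<longleftrightarrow>
     (\<forall>i\<in>{1..n}. \<forall>j\<in>{1..n}. A i j = A j i) \<and>
     (\<forall>u :: nat \<Rightarrow> real. 0 \<le> (\<Sum>i=1..n. \<Sum>j=1..n. u i * A i j * u j))"

definition std_gaussian :: "nat \<Rightarrow> (nat \<Rightarrow> real) measure" where
  "std_gaussian n = (\<Pi>\<^sub>M i\<in>{1..n}. density lborel std_normal_density)"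

definition cov_factor :: "nat \<Rightarrow> (nat \<Rightarrow> nat \<Rightarrow> real) \<Rightarrow> nat \<Rightarrow> nat \<Rightarrow> real" where
  "cov_factor n A =
     (SOME B. \<forall>i\<in>{1..n}. \<forall>j\<in>{1..n}. (\<Sum>l=1..n. B i l * B j l) = A i j)"

text \<open>
  The law \<open>\<N>(0, A)\<close> is the law of \<open>B Z\<close>, where \<open>Z\<close> is standard Gaussian and \<open>B B\<^sup>T = A\<close>. Such
  a \<open>B\<close> exists exactly when \<open>A\<close> is a covariance matrix, and the law does not depend on which one
  is chosen. Singular \<open>A\<close> (for instance \<open>\<rho> = 1\<close> in the exact correlation model) has no density
  but is covered.
\<close>

definition gaussian :: "nat \<Rightarrow> (nat \<Rightarrow> nat \<Rightarrow> real) \<Rightarrow> (nat \<Rightarrow> real) measure" where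
  "gaussian n A =
     distr (std_gaussian n) (\<Pi>\<^sub>M i\<in>{1..n}. borel)
       (\<lambda>z. \<lambda>i\<in>{1..n}. \<Sum>l=1..n. cov_factor n A i l * z l)"

definition null_law :: "nat \<Rightarrow> (nat \<Rightarrow> real) measure" where
  "null_law n = gaussian n (\<lambda>i j. if i = j then 1 else 0)"

definition general_model :: "nat \<Rightarrow> nat set \<Rightarrow> real \<Rightarrow> (nat \<Rightarrow> nat \<Rightarrow> real) set" where
  "general_model n S \<rho> =
     {A. covariance_matrix n A \<and>
         (\<forall>i\<in>{1..n}. \<forall>j\<in>{1..n}.
            (i = j \<longrightarrow> A i j = 1) \<and>
            (i \<noteq> j \<and> i \<in> S \<and> j \<in> S \<longrightarrow> \<rho> \<le> A i j) \<and>
            (i \<noteq> j \<and> \<not> (i \<in> S \<and> j \<in> S) \<longrightarrow> A i j = 0))}"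

definition exact_cov :: "nat set \<Rightarrow> real \<Rightarrow> nat \<Rightarrow> nat \<Rightarrow> real" where
  "exact_cov S \<rho> i j = (if i = j then 1 else if i \<in> S \<and> j \<in> S then \<rho> else 0)"

definition exact_law :: "nat \<Rightarrow> nat set \<Rightarrow> real \<Rightarrow> (nat \<Rightarrow> real) measure" where
  "exact_law n S \<rho> = gaussian n (exact_cov S \<rho>)"

definition squared_sum :: "nat \<Rightarrow> (nat \<Rightarrow> real) \<Rightarrow> real" where
  "squared_sum n x = (\<Sum>i=1..n. x i)\<^sup>2"

text \<open>Measurability into \<^term>\<open>count_space {0, 1}\<close> forces \<open>g\<close> to take only the values 0 and 1.\<close>

definition squared_sum_based_test :: "nat \<Rightarrow> ((nat \<Rightarrow> real) \<Rightarrow> nat) \<Rightarrow> bool" where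
  "squared_sum_based_test n f \<longleftrightarrow>
     (\<exists>g \<in> borel \<rightarrow>\<^sub>M count_space {0, 1}.
        \<forall>x \<in> space (\<Pi>\<^sub>M i\<in>{1..n}. borel :: real measure). f x = g (squared_sum n x))"

end

theory Submission
  imports Defs
begin

text \<open>
  Under \<open>\<N>(0, A)\<close> the sum of the coordinates is a centred Gaussian with variance equal to the sum of
  all entries of \<open>A\<close>: this is \<open>n\<close> under the null, at least \<open>n - \<rho> k + \<rho> k\<^sup>2 \<ge> \<rho> k\<^sup>2\<close> in the general model,
  and exactly \<open>n - \<rho> k + \<rho> k\<^sup>2\<close> in the exact model. For (i), Markov's inequality bounds the type I error
  by \<open>1 / t\<close>, and boundedness of the Gaussian density bounds the type II error by
  \<open>sqrt (n t / (\<rho> k\<^sup>2))\<close>. For (ii), the centred Gaussian density of standard deviation \<open>s'\<close> is at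
  least \<open>s / s'\<close> times that of standard deviation \<open>s \<le> s'\<close>, so every test based on the squared sum has
  risk at least \<open>s / s'\<close>, and this ratio tends to 1 when the variances are asymptotically equal.
\<close>

section \<open>Factorisation of covariance matrices\<close>

text \<open>Evaluate the quadratic form at \<open>u\<close> extended by the last coordinate
  \<open>r\<close>. As a polynomial in \<open>r\<close> it can be tested at any convenient point,
  which the factorisation does in three ways.\<close>

lemma covariance_matrix_Suc_quadratic:
  assumes "covariance_matrix (Suc n) A"
  shows "0 \<le> (\<Sum>i=1..n. \<Sum>j=1..n. u i * A i j * u j) + 2 * r * (\<Sum>i=1..n. u i * A i (Suc n))
           + r\<^sup>2 * A (Suc n) (Suc n)"
proof -
  define v where "v = u(Suc n := r)"
  have v: "v i = u i" if "i \<in> {1..n}" for i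
    using that by (auto simp: v_def)
  have vN: "v (Suc n) = r"
    by (simp add: v_def)
  have sym: "A (Suc n) i = A i (Suc n)" if "i \<in> {1..n}" for i
    using assms that unfolding covariance_matrix_def by auto
  have "0 \<le> (\<Sum>i=1..Suc n. \<Sum>j=1..Suc n. v i * A i j * v j)"
    using assms unfolding covariance_matrix_def by blast
  also have "\<dots> = (\<Sum>i=1..n. (\<Sum>j=1..n. v i * A i j * v j) + v i * A i (Suc n) * v (Suc n))
      + ((\<Sum>j=1..n. v (Suc n) * A (Suc n) j * v j) + v (Suc n) * A (Suc n) (Suc n) * v (Suc n))"
    by simp
  also have "\<dots> = (\<Sum>i=1..n. (\<Sum>j=1..n. u i * A i j * u j) + r * (u i * A i (Suc n)))
      + ((\<Sum>j=1..n. r * (u j * A j (Suc n))) + r * A (Suc n) (Suc n) * r)"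
    unfolding vN by (intro arg_cong2[where f="(+)"] sum.cong refl) (simp_all add: v sym)
  also have "\<dots> = (\<Sum>i=1..n. \<Sum>j=1..n. u i * A i j * u j) + 2 * r * (\<Sum>i=1..n. u i * A i (Suc n))
           + r\<^sup>2 * A (Suc n) (Suc n)"
    by (simp add: sum.distrib sum_distrib_left[symmetric] power2_eq_square)
  finally show ?thesis .
qed

text \<open>Cholesky-type induction on the dimension: split off the last row and column, factor the
  Schur complement by the induction hypothesis, and restore the rest with one extra column. This
  makes the choice in \<open>cov_factor\<close> a genuine factor.\<close>

lemma covariance_matrix_factor:
  assumes "covariance_matrix n A"
  shows "\<exists>B. \<forall>i\<in>{1..n}. \<forall>j\<in>{1..n}. (\<Sum>l=1..n. B i l * B j l) = A i j"
  using assms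
proof (induction n arbitrary: A)
  case 0
  then show ?case by simp
next
  case (Suc n)
  note quad = covariance_matrix_Suc_quadratic[OF Suc.prems]
  define a where "a = A (Suc n) (Suc n)"
  define b where "b i = A i (Suc n)" for i
  have sym: "A i j = A j i" if "i \<in> {1..Suc n}" "j \<in> {1..Suc n}" for i j
    using Suc.prems that unfolding covariance_matrix_def by auto
  have a_nonneg: "0 \<le> a"
    using quad[of "\<lambda>_. 0" 1] by (simp add: a_def)
  have b_zero: "b i = 0" if "a = 0" "i \<in> {1..n}" for i
  proof (rule ccontr)
    assume "b i \<noteq> 0"
    \<comment> \<open>At the \<open>i\<close>-th unit vector, \<open>a = 0\<close> leaves the form
      affine in \<open>r\<close>. An affine function bounded below on the whole line has slope 0;
      the \<open>r\<close> chosen next would give it the value -1.\<close>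
    have "0 \<le> A i i + 2 * r * b i" for r
      using quad[of "\<lambda>j. if j = i then 1 else 0" r] that
      by (simp add: a_def b_def if_distrib[where f="\<lambda>x. x * _"] if_distrib[where f="\<lambda>x. _ * x"]
          sum.delta cong: if_cong)
    from this[of "- (A i i + 1) / (2 * b i)"] have "0 \<le> A i i - (A i i + 1)"
      using \<open>b i \<noteq> 0\<close> by (simp add: field_simps)
    then show False
      by simp
  qed
  \<comment> \<open>The Schur complement; for \<open>a = 0\<close> the junk value \<open>x / 0 = 0\<close> gives the right matrix.\<close>
  define A' where "A' i j = A i j - b i * b j / a" for i j
  have "covariance_matrix n A'"
    unfolding covariance_matrix_def
  proof (intro conjI ballI allI)
    fix i j assume "i \<in> {1..n}" "j \<in> {1..n}"
    then show "A' i j = A' j i"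
      using sym[of i j] by (simp add: A'_def)
  next
    fix u :: "nat \<Rightarrow> real"
    define w where "w = (\<Sum>i=1..n. u i * b i)"
    have "(\<Sum>i=1..n. \<Sum>j=1..n. u i * A' i j * u j)
        = (\<Sum>i=1..n. \<Sum>j=1..n. u i * A i j * u j - (u i * b i) * (u j * b j) / a)"
      by (intro sum.cong refl) (simp add: A'_def algebra_simps)
    also have "\<dots> = (\<Sum>i=1..n. \<Sum>j=1..n. u i * A i j * u j) - w\<^sup>2 / a"
      by (simp add: w_def sum_subtractf power2_eq_square sum_product sum_divide_distrib)
    \<comment> \<open>For \<open>a > 0\<close>, \<open>r = - w / a\<close> minimises the bordered
      form over \<open>r\<close>, and the minimum is the form of the Schur complement. For
      \<open>a = 0\<close> all the quotients are 0.\<close>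
    also have "\<dots> = (\<Sum>i=1..n. \<Sum>j=1..n. u i * A i j * u j) + 2 * (- w / a) * w + (- w / a)\<^sup>2 * a"
      by (cases "a = 0") (simp_all add: field_simps power2_eq_square)
    also have "\<dots> \<ge> 0"
      using quad[of u "- w / a"] by (simp add: w_def a_def b_def)
    finally show "0 \<le> (\<Sum>i=1..n. \<Sum>j=1..n. u i * A' i j * u j)" .
  qed
  from Suc.IH[OF this] obtain B
    where B: "\<And>i j. i \<in> {1..n} \<Longrightarrow> j \<in> {1..n} \<Longrightarrow> (\<Sum>l=1..n. B i l * B j l) = A' i j"
    by blast
  \<comment> \<open>The new column contributes \<open>b i * b j / a\<close>, exactly what
    \<open>A'\<close> subtracted, and the last row has \<open>sqrt a\<close> as its only possibly
    nonzero entry. For \<open>a = 0\<close> the column vanishes, consistently with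
    \<open>b_zero\<close>.\<close>
  define B' where "B' i l = (if l = Suc n then (if i = Suc n then sqrt a else b i / sqrt a)
      else if i = Suc n then 0 else B i l)" for i l
  have last: "B' i (Suc n) * B' (Suc n) (Suc n) = b i" if "i \<in> {1..n}" for i
    using that a_nonneg b_zero[of i] by (cases "a = 0") (auto simp: B'_def)
  have "(\<Sum>l=1..Suc n. B' i l * B' j l) = A i j"
    if i: "i \<in> {1..Suc n}" and j: "j \<in> {1..Suc n}" for i j
  proof (cases "i = Suc n \<or> j = Suc n")
    case True
    then have "(\<Sum>l=1..n. B' i l * B' j l) = 0"
      by (intro sum.neutral) (auto simp: B'_def)
    moreover have "B' i (Suc n) * B' j (Suc n) = A i j"
    proof (cases "i = Suc n \<and> j = Suc n")
      case True
      then show ?thesis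
        using a_nonneg by (simp add: B'_def a_def)
    next
      case False
      with True i j consider "i = Suc n" "j \<in> {1..n}" | "j = Suc n" "i \<in> {1..n}"
        by force
      then show ?thesis
        using last[of i] last[of j] sym[OF i j] by cases (auto simp: b_def mult.commute)
    qed
    ultimately show ?thesis
      by simp
  next
    case False
    then have ij: "i \<in> {1..n}" "j \<in> {1..n}"
      using i j by auto
    have "(\<Sum>l=1..n. B' i l * B' j l) = (\<Sum>l=1..n. B i l * B j l)"
      using False by (intro sum.cong) (auto simp: B'_def)
    also have "\<dots> = A' i j"
      by (rule B[OF ij])
    finally show ?thesis
      using False a_nonneg by (simp add: B'_def A'_def)
  qed
  then show ?case
    by blast
qed

text \<open>The left side is the variance of the coordinate sum of \<open>B Z\<close>. Expanding the
  squares and exchanging sums turns it into the entries of \<open>B B^T\<close>, so the arbitrary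
  choice of factor drops out.\<close>

lemma sum_cov_factor_squares:
  assumes "covariance_matrix n A"
  shows "(\<Sum>l=1..n. (\<Sum>i=1..n. cov_factor n A i l)\<^sup>2) = (\<Sum>i=1..n. \<Sum>j=1..n. A i j)"
proof -
  let ?B = "cov_factor n A"
  have B: "(\<Sum>l=1..n. ?B i l * ?B j l) = A i j" if "i \<in> {1..n}" "j \<in> {1..n}" for i j
    using someI_ex[OF covariance_matrix_factor[OF assms]] that unfolding cov_factor_def by blast
  have "(\<Sum>l=1..n. (\<Sum>i=1..n. ?B i l)\<^sup>2) = (\<Sum>l=1..n. \<Sum>i=1..n. \<Sum>j=1..n. ?B i l * ?B j l)"
    by (simp add: power2_eq_square sum_product)
  also have "\<dots> = (\<Sum>i=1..n. \<Sum>j=1..n. \<Sum>l=1..n. ?B i l * ?B j l)"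
    by (subst sum.swap, rule sum.cong[OF refl], rule sum.swap)
  also have "\<dots> = (\<Sum>i=1..n. \<Sum>j=1..n. A i j)"
    by (intro sum.cong refl B)
  finally show ?thesis .
qed

section \<open>Linear functionals of a standard Gaussian vector\<close>

lemma prob_space_std_gaussian: "prob_space (std_gaussian n)"
  unfolding std_gaussian_def by (intro prob_space_PiM prob_space_normal_density) simp

lemma space_std_gaussian: "space (std_gaussian n) = space (\<Pi>\<^sub>M i\<in>{1..n}. borel)"
  by (simp add: std_gaussian_def space_PiM)

lemma sets_std_gaussian [measurable_cong]: "sets (std_gaussian n) = sets (\<Pi>\<^sub>M i\<in>{1..n}. borel)"
  unfolding std_gaussian_def by (intro sets_PiM_cong) simp_all

lemma distributed_linear_std_gaussian:
  assumes "(\<Sum>l=1..n. (c l)\<^sup>2) > 0"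
  shows "distributed (std_gaussian n) lborel (\<lambda>z. \<Sum>l=1..n. c l * z l)
           (normal_density 0 (sqrt (\<Sum>l=1..n. (c l)\<^sup>2)))"
proof -
  interpret prob_space "std_gaussian n"
    by (rule prob_space_std_gaussian)
  \<comment> \<open>A term with \<open>c l = 0\<close> is constant and has no density, so only the
    nonzero coefficients enter the sum of independent normals. Positivity of the variance keeps
    \<open>I\<close> nonempty.\<close>
  define I where "I = {l\<in>{1..n}. c l \<noteq> 0}"
  have I: "I \<subseteq> {1..n}" "finite I"
    by (auto simp: I_def)
  have ne: "I \<noteq> {}"
  proof
    assume "I = {}"
    then have "(\<Sum>l=1..n. (c l)\<^sup>2) = 0"
      by (intro sum.neutral) (auto simp: I_def)
    with assms show False by simp
  qed
  have rv: "(\<lambda>z. z l) \<in> borel_measurable (std_gaussian n)" if "l \<in> {1..n}" for l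
    using that by measurable
  have comp: "distr (std_gaussian n) borel (\<lambda>z. z l) = density lborel std_normal_density"
    if "l \<in> {1..n}" for l
  proof -
    have "distr (std_gaussian n) borel (\<lambda>z. z l)
        = distr (std_gaussian n) (density lborel std_normal_density) (\<lambda>z. z l)"
      by (rule distr_cong) simp_all
    also have "\<dots> = density lborel std_normal_density"
      unfolding std_gaussian_def
      by (rule distr_PiM_component[OF _ that]) (simp add: prob_space_normal_density)
    finally show ?thesis .
  qed
  \<comment> \<open>Independence of the coordinates amounts to their joint law being the product of
    the marginals. The joint law is the measure itself, since its points are already
    extensional.\<close>
  have "indep_vars (\<lambda>_. borel) (\<lambda>l z. z l) {1..n}"
  proof (subst indep_vars_iff_distr_eq_PiM')
    show "{1..n} \<noteq> {}"
      using ne I by auto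
    have "distr (std_gaussian n) (\<Pi>\<^sub>M i\<in>{1..n}. borel) (\<lambda>x. \<lambda>i\<in>{1..n}. x i)
        = distr (std_gaussian n) (std_gaussian n) (\<lambda>x. x)"
      by (rule distr_cong)
        (auto simp: sets_std_gaussian space_std_gaussian space_PiM PiE_def extensional_def restrict_def)
    also have "\<dots> = (\<Pi>\<^sub>M i\<in>{1..n}. distr (std_gaussian n) borel (\<lambda>z. z i))"
      unfolding distr_id2[OF refl] by (subst std_gaussian_def, intro PiM_cong refl) (simp add: comp)
    finally show "distr (std_gaussian n) (\<Pi>\<^sub>M i\<in>{1..n}. borel) (\<lambda>x. \<lambda>i\<in>{1..n}. x i)
        = (\<Pi>\<^sub>M i\<in>{1..n}. distr (std_gaussian n) borel (\<lambda>z. z i))" .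
  qed (rule rv)
  then have "indep_vars (\<lambda>_. borel) (\<lambda>l z. z l) I"
    by (rule indep_vars_subset) (rule I)
  then have indep: "indep_vars (\<lambda>_. borel) (\<lambda>l z. c l * z l) I"
    by (rule indep_vars_compose2) simp
  have "distributed (std_gaussian n) lborel (\<lambda>z. c l * z l) (normal_density 0 \<bar>c l\<bar>)"
    if "l \<in> I" for l
  proof -
    have l: "l \<in> {1..n}" "c l \<noteq> 0"
      using that by (auto simp: I_def)
    have "distributed (std_gaussian n) lborel (\<lambda>z. z l) std_normal_density"
      using comp[OF l(1)] rv[OF l(1)] unfolding distributed_def
      by (auto cong: distr_cong)
    from normal_density_affine[OF this _ l(2), of 0] show ?thesis
      by simp
  qed
  from sum_indep_normal[OF I(2) ne indep _ this]
  have "distributed (std_gaussian n) lborel (\<lambda>z. \<Sum>l\<in>I. c l * z l)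
      (normal_density 0 (sqrt (\<Sum>l\<in>I. (c l)\<^sup>2)))"
    by (simp add: I_def)
  moreover have "(\<Sum>l\<in>I. c l * z l) = (\<Sum>l=1..n. c l * z l)" for z
    by (rule sum.mono_neutral_left) (auto simp: I_def)
  moreover have "(\<Sum>l\<in>I. (c l)\<^sup>2) = (\<Sum>l=1..n. (c l)\<^sup>2)"
    by (rule sum.mono_neutral_left) (auto simp: I_def)
  ultimately show ?thesis
    by simp
qed

section \<open>The law of the coordinate sum\<close>

lemma space_gaussian [simp]: "space (gaussian n A) = space (\<Pi>\<^sub>M i\<in>{1..n}. borel)"
  by (simp add: gaussian_def)

lemma sets_gaussian [measurable_cong]: "sets (gaussian n A) = sets (\<Pi>\<^sub>M i\<in>{1..n}. borel)"
  by (simp add: gaussian_def)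

lemma measurable_gaussian_map:
  "(\<lambda>z. \<lambda>i\<in>{1..n}. \<Sum>l=1..n. cov_factor n A i l * z l)
     \<in> measurable (std_gaussian n) (\<Pi>\<^sub>M i\<in>{1..n}. borel)"
  by measurable

text \<open>The coordinate sum of \<open>B z\<close> is a linear functional of \<open>z\<close>
  whose coefficients are the column sums of \<open>B\<close>. Positivity of the total rules out a
  point mass at 0.\<close>

lemma distr_sum_gaussian:
  assumes A: "covariance_matrix n A" and pos: "(\<Sum>i=1..n. \<Sum>j=1..n. A i j) > 0"
  shows "distr (gaussian n A) borel (\<lambda>x. \<Sum>i=1..n. x i)
           = density lborel (normal_density 0 (sqrt (\<Sum>i=1..n. \<Sum>j=1..n. A i j)))"
proof -
  let ?c = "\<lambda>l. \<Sum>i=1..n. cov_factor n A i l"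
  have "distr (gaussian n A) borel (\<lambda>x. \<Sum>i=1..n. x i)
      = distr (std_gaussian n) borel
          ((\<lambda>x. \<Sum>i=1..n. x i) \<circ> (\<lambda>z. \<lambda>i\<in>{1..n}. \<Sum>l=1..n. cov_factor n A i l * z l))"
    unfolding gaussian_def by (rule distr_distr[OF _ measurable_gaussian_map]) measurable
  also have "\<dots> = distr (std_gaussian n) lborel (\<lambda>z. \<Sum>l=1..n. ?c l * z l)"
  proof (rule distr_cong)
    fix z
    have "(\<Sum>i=1..n. \<Sum>l=1..n. cov_factor n A i l * z l) = (\<Sum>l=1..n. ?c l * z l)"
      by (subst sum.swap) (simp add: sum_distrib_right)
    then show "((\<lambda>x. \<Sum>i=1..n. x i) \<circ> (\<lambda>z. \<lambda>i\<in>{1..n}. \<Sum>l=1..n. cov_factor n A i l * z l)) z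
        = (\<Sum>l=1..n. ?c l * z l)"
      by simp
  qed simp_all
  also have "\<dots> = density lborel (normal_density 0 (sqrt (\<Sum>l=1..n. (?c l)\<^sup>2)))"
    by (intro distributed_distr_eq_density distributed_linear_std_gaussian)
      (unfold sum_cov_factor_squares[OF A], rule pos)
  finally show ?thesis
    unfolding sum_cov_factor_squares[OF A] .
qed

text \<open>An arbitrary measurable \<open>P\<close> covers both the threshold events of the first
  claim and the arbitrary tests of the second.\<close>

lemma measure_squared_sum_gaussian:
  assumes "covariance_matrix n A" "(\<Sum>i=1..n. \<Sum>j=1..n. A i j) > 0"
    and P: "Measurable.pred borel P"
  shows "measure (gaussian n A) {x \<in> space (gaussian n A). P (squared_sum n x)}
           = measure (density lborel (normal_density 0 (sqrt (\<Sum>i=1..n. \<Sum>j=1..n. A i j))))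
               {y. P (y\<^sup>2)}"
proof -
  have [measurable]: "Measurable.pred borel (\<lambda>y :: real. P (y\<^sup>2))"
    by (rule measurable_compose[OF _ P]) simp
  have "(\<lambda>x. \<Sum>i=1..n. x i) \<in> borel_measurable (gaussian n A)"
    by measurable
  from measure_distr[OF this, of "{y. P (y\<^sup>2)}"] show ?thesis
    unfolding distr_sum_gaussian[OF assms(1,2)] squared_sum_def
    by (simp add: vimage_def Int_def conj_commute)
qed


section \<open>Estimates for one-dimensional normal laws\<close>

lemma normal_tail_bound:
  assumes "0 < \<sigma>" "0 < c"
  shows "measure (density lborel (normal_density 0 \<sigma>)) {y. c < y\<^sup>2} \<le> \<sigma>\<^sup>2 / c"
proof -
  let ?M = "density lborel (normal_density 0 \<sigma>)"
  interpret prob_space ?M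
    by (rule prob_space_normal_density) fact
  have "integrable ?M (\<lambda>y. y\<^sup>2)"
    using integrable_normal_moment[OF assms(1), of 0 2] by (simp add: integrable_real_density)
  from integral_Markov_inequality_measure[OF this sets.top _ assms(2)]
  have "measure ?M {y. c \<le> y\<^sup>2} \<le> (\<integral>y. y\<^sup>2 \<partial>?M) / c"
    by simp
  moreover have "(\<integral>y. y\<^sup>2 \<partial>?M) = \<sigma>\<^sup>2"
    using integral_normal_moment_even[OF assms(1), of 0 1]
    by (simp add: integral_real_density numeral_2_eq_2)
  moreover have "measure ?M {y. c < y\<^sup>2} \<le> measure ?M {y. c \<le> y\<^sup>2}"
    by (rule finite_measure_mono) auto
  ultimately show ?thesis
    by simp
qed

text \<open>The peak is \<open>1 / (\<sigma> * sqrt (2 * pi))\<close>, and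
  \<open>sqrt (2 * pi)\<close> is at least 2.\<close>

lemma normal_density_le:
  assumes "0 < \<sigma>"
  shows "normal_density \<mu> \<sigma> x \<le> 1 / (2 * \<sigma>)"
proof -
  have "2 * \<sigma> = sqrt ((2 * \<sigma>)\<^sup>2)"
    using assms unfolding real_sqrt_abs by simp
  also have "\<dots> \<le> sqrt (2 * pi * \<sigma>\<^sup>2)"
    using pi_gt3 by (auto simp: power_mult_distrib intro!: mult_right_mono)
  finally have "1 / sqrt (2 * pi * \<sigma>\<^sup>2) \<le> 1 / (2 * \<sigma>)"
    using assms by (intro divide_left_mono) auto
  moreover have "exp (- (x - \<mu>)\<^sup>2 / (2 * \<sigma>\<^sup>2)) \<le> 1"
    by simp
  ultimately have "1 / sqrt (2 * pi * \<sigma>\<^sup>2) * exp (- (x - \<mu>)\<^sup>2 / (2 * \<sigma>\<^sup>2)) \<le> 1 / (2 * \<sigma>) * 1"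
    using assms by (intro mult_mono) auto
  then show ?thesis
    by (simp add: normal_density_def)
qed

text \<open>The event is an interval of length \<open>2 * sqrt c\<close>, and the density is at most
  \<open>1 / (2 * \<sigma>)\<close>.\<close>

lemma normal_small_ball_bound:
  assumes "0 < \<sigma>" "0 \<le> c"
  shows "measure (density lborel (normal_density 0 \<sigma>)) {y. y\<^sup>2 \<le> c} \<le> sqrt c / \<sigma>"
proof -
  let ?M = "density lborel (normal_density 0 \<sigma>)"
  interpret prob_space ?M
    by (rule prob_space_normal_density) fact
  have eq: "{y. y\<^sup>2 \<le> c} = {- sqrt c..sqrt c}"
  proof (intro set_eqI)
    fix y
    have "y\<^sup>2 \<le> c \<longleftrightarrow> \<bar>y\<bar> \<le> sqrt c"
      using real_sqrt_le_iff[of "y\<^sup>2" c] unfolding real_sqrt_abs by simp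
    then show "y \<in> {y. y\<^sup>2 \<le> c} \<longleftrightarrow> y \<in> {- sqrt c..sqrt c}"
      unfolding atLeastAtMost_iff mem_Collect_eq by linarith
  qed
  have "emeasure ?M {- sqrt c..sqrt c}
      = (\<integral>\<^sup>+y. ennreal (normal_density 0 \<sigma> y) * indicator {- sqrt c..sqrt c} y \<partial>lborel)"
    by (simp add: emeasure_density)
  also have "\<dots> \<le> (\<integral>\<^sup>+y. ennreal (1 / (2 * \<sigma>)) * indicator {- sqrt c..sqrt c} y \<partial>lborel)"
    using assms by (intro nn_integral_mono mult_right_mono ennreal_leI normal_density_le) auto
  also have "\<dots> = ennreal (1 / (2 * \<sigma>)) * ennreal (sqrt c - (- sqrt c))"
    using assms by (subst nn_integral_cmult_indicator) simp_all
  also have "\<dots> = ennreal (sqrt c / \<sigma>)"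
    using assms by (subst ennreal_mult[symmetric]) (simp_all add: field_simps)
  finally have "ennreal (measure ?M {- sqrt c..sqrt c}) \<le> ennreal (sqrt c / \<sigma>)"
    by (simp add: emeasure_eq_measure)
  then show ?thesis
    unfolding eq using assms by simp
qed

text \<open>The factor \<open>s / s'\<close> matches the normalising constants, and the exponential
  factor only grows with the standard deviation. The pointwise inequality is then integrated over
  \<open>B\<close>.\<close>

lemma normal_measure_comparison:
  assumes "0 < s" "s \<le> s'" and B: "B \<in> sets borel"
  shows "s / s' * measure (density lborel (normal_density 0 s)) B
           \<le> measure (density lborel (normal_density 0 s')) B"
proof -
  interpret M: prob_space "density lborel (normal_density 0 s)"
    by (rule prob_space_normal_density) fact
  interpret M': prob_space "density lborel (normal_density 0 s')"
    by (rule prob_space_normal_density) (use assms in auto)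
  have "s / s' * normal_density 0 s x \<le> normal_density 0 s' x" for x
  proof -
    have "x\<^sup>2 / (2 * s'\<^sup>2) \<le> x\<^sup>2 / (2 * s\<^sup>2)"
      using assms by (intro divide_left_mono mult_left_mono power_mono mult_pos_pos) auto
    moreover have "s / s' * normal_density 0 s x = 1 / sqrt (2 * pi * s'\<^sup>2) * exp (- (x\<^sup>2 / (2 * s\<^sup>2)))"
      using assms by (simp add: normal_density_def real_sqrt_mult)
    moreover have "normal_density 0 s' x = 1 / sqrt (2 * pi * s'\<^sup>2) * exp (- (x\<^sup>2 / (2 * s'\<^sup>2)))"
      by (simp add: normal_density_def)
    ultimately show ?thesis
      by (simp add: divide_right_mono)
  qed
  then have "(\<integral>\<^sup>+x. ennreal (s / s' * normal_density 0 s x) * indicator B x \<partial>lborel)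
      \<le> (\<integral>\<^sup>+x. ennreal (normal_density 0 s' x) * indicator B x \<partial>lborel)"
    by (intro nn_integral_mono mult_right_mono ennreal_leI) auto
  moreover have "(\<integral>\<^sup>+x. ennreal (s / s' * normal_density 0 s x) * indicator B x \<partial>lborel)
      = ennreal (s / s') * (\<integral>\<^sup>+x. ennreal (normal_density 0 s x) * indicator B x \<partial>lborel)"
    using assms B by (subst nn_integral_cmult[symmetric])
      (simp_all add: ennreal_mult mult.assoc del: times_divide_eq_left)
  ultimately have "ennreal (s / s') * emeasure (density lborel (normal_density 0 s)) B
      \<le> emeasure (density lborel (normal_density 0 s')) B"
    using B by (simp add: emeasure_density)
  then show ?thesis
    using assms by (simp add: M.emeasure_eq_measure M'.emeasure_eq_measure flip: ennreal_mult)
qed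

section \<open>Variances in the two correlation models\<close>

text \<open>The matrix is a diagonal matrix plus \<open>r\<close> times the rank-one matrix of the
  indicator of \<open>S\<close>. For \<open>r\<close> in [0,1] both parts are positive semidefinite,
  and the vector of ones gives the total of the entries.\<close>

lemma exact_cov_quadratic:
  assumes "S \<subseteq> {1..n}"
  shows "(\<Sum>i=1..n. \<Sum>j=1..n. u i * exact_cov S r i j * u j)
           = (\<Sum>i=1..n. (if i \<in> S then 1 - r else 1) * (u i)\<^sup>2) + r * (\<Sum>i\<in>S. u i)\<^sup>2"
proof -
  define v where "v i = (if i \<in> S then u i else 0)" for i
  have "u i * exact_cov S r i j * u j
      = (if i = j then (if i \<in> S then 1 - r else 1) * (u i)\<^sup>2 else 0) + r * (v i * v j)" for i j
    by (simp add: exact_cov_def v_def power2_eq_square algebra_simps)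
  then have "(\<Sum>i=1..n. \<Sum>j=1..n. u i * exact_cov S r i j * u j)
      = (\<Sum>i=1..n. (if i \<in> S then 1 - r else 1) * (u i)\<^sup>2) + r * (\<Sum>i=1..n. v i)\<^sup>2"
    by (simp add: sum.distrib power2_eq_square sum_product flip: sum_distrib_left)
  also have "(\<Sum>i=1..n. v i) = (\<Sum>i\<in>S. u i)"
    using assms by (simp add: v_def Int_absorb1 flip: sum.inter_restrict)
  finally show ?thesis .
qed

lemma covariance_matrix_exact_cov:
  assumes "S \<subseteq> {1..n}" "0 \<le> r" "r \<le> 1"
  shows "covariance_matrix n (exact_cov S r)"
  unfolding covariance_matrix_def exact_cov_quadratic[OF assms(1)]
  using assms(2,3) by (auto simp: exact_cov_def intro!: add_nonneg_nonneg sum_nonneg)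

lemma sum_exact_cov:
  assumes "S \<subseteq> {1..n}"
  shows "(\<Sum>i=1..n. \<Sum>j=1..n. exact_cov S r i j) = real n - r * real (card S) + r * (real (card S))\<^sup>2"
proof -
  have "(\<Sum>i=1..n. if i \<in> S then 1 - r else 1) = (\<Sum>i=1..n. 1 - (if i \<in> S then r else 0))"
    by (intro sum.cong) auto
  also have "\<dots> = real n - r * real (card S)"
    using assms by (simp add: sum_subtractf Int_absorb1 flip: sum.inter_restrict)
  finally show ?thesis
    using exact_cov_quadratic[OF assms, of "\<lambda>_. 1" r] by simp
qed

text \<open>Supplies a member of the general model, so that the supremum over it is over a nonempty
  set.\<close>

lemma exact_cov_in_general_model:
  assumes "S \<subseteq> {1..n}" "0 \<le> r" "r \<le> 1"
  shows "exact_cov S r \<in> general_model n S r"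
  unfolding general_model_def using covariance_matrix_exact_cov[OF assms]
  by (auto simp: exact_cov_def)

text \<open>\<open>exact_cov\<close> is the entrywise smallest matrix of the model.\<close>

lemma sum_general_model_ge:
  assumes "A \<in> general_model n S r" "S \<subseteq> {1..n}"
  shows "real n - r * real (card S) + r * (real (card S))\<^sup>2 \<le> (\<Sum>i=1..n. \<Sum>j=1..n. A i j)"
  unfolding sum_exact_cov[OF assms(2), symmetric]
  using assms(1) by (intro sum_mono) (auto simp: general_model_def exact_cov_def)

section \<open>Error probabilities for fixed \<open>n\<close>\<close>

lemma measure_squared_sum_null:
  assumes "0 < n" "Measurable.pred borel P"
  shows "measure (null_law n) {x \<in> space (null_law n). P (squared_sum n x)}
           = measure (density lborel (normal_density 0 (sqrt (real n)))) {y. P (y\<^sup>2)}"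
proof -
  \<comment> \<open>The null covariance is the degenerate exact model with empty \<open>S\<close>,
    so the variance formula there yields \<open>n\<close>.\<close>
  have "(\<lambda>i j. if i = j then 1 else 0) = exact_cov {} 0"
    by (auto simp: exact_cov_def fun_eq_iff)
  then show ?thesis
    using measure_squared_sum_gaussian[OF covariance_matrix_exact_cov[of "{}" n 0] _ assms(2)] assms(1)
      sum_exact_cov[of "{}" n 0]
    by (simp add: null_law_def)
qed

lemma measure_squared_sum_exact:
  assumes "S \<subseteq> {1..n}" "0 \<le> r" "r \<le> 1" "0 < n" "Measurable.pred borel P"
    and "\<sigma>2 = real n - r * real (card S) + r * (real (card S))\<^sup>2" "0 < \<sigma>2"
  shows "measure (exact_law n S r) {x \<in> space (exact_law n S r). P (squared_sum n x)}
           = measure (density lborel (normal_density 0 (sqrt \<sigma>2))) {y. P (y\<^sup>2)}"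
  using measure_squared_sum_gaussian[OF covariance_matrix_exact_cov[OF assms(1-3)] _ assms(5)]
    assms(6,7) sum_exact_cov[OF assms(1), of r]
  by (simp add: exact_law_def)

lemma null_rejection_le:
  assumes "0 < n" "0 < t"
  shows "measure (null_law n) {x \<in> space (null_law n). squared_sum n x > real n * t} \<le> 1 / t"
  using normal_tail_bound[of "sqrt (real n)" "real n * t"] assms
  by (subst measure_squared_sum_null) simp_all

text \<open>The bound depends on \<open>S\<close> only through its size and not on \<open>A\<close>,
  hence survives both suprema. It is written through the ratio that the little-o condition sends to
  0.\<close>

lemma general_acceptance_le:
  assumes A: "A \<in> general_model n S r" and S: "S \<subseteq> {1..n}" "card S = k" "0 < k"
    and r: "0 < r" "r \<le> 1" and t: "0 \<le> t"
  shows "measure (gaussian n A) {x \<in> space (gaussian n A). squared_sum n x \<le> real n * t}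
           \<le> sqrt (t / (r * (real k)\<^sup>2 / real n))"
proof -
  define v where "v = (\<Sum>i=1..n. \<Sum>j=1..n. A i j)"
  have kn: "k \<le> n"
    using card_mono[OF _ S(1)] S(2) by simp
  have "r * real k \<le> 1 * real n"
    using r kn by (intro mult_mono) auto
  then have v: "r * (real k)\<^sup>2 \<le> v"
    using sum_general_model_ge[OF A S(1)] S(2) by (simp add: v_def)
  have pos: "0 < r * (real k)\<^sup>2"
    using r S by simp
  have "measure (gaussian n A) {x \<in> space (gaussian n A). squared_sum n x \<le> real n * t}
      \<le> sqrt (real n * t) / sqrt v"
    using A v pos t unfolding v_def
    by (subst measure_squared_sum_gaussian)
      (auto simp: general_model_def intro!: normal_small_ball_bound)
  also have "\<dots> \<le> sqrt (real n * t) / sqrt (r * (real k)\<^sup>2)"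
    using v pos t by (intro divide_left_mono mult_pos_pos) auto
  also have "\<dots> = sqrt (t / (r * (real k)\<^sup>2 / real n))"
    by (simp add: real_sqrt_divide[symmetric] mult.commute del: real_sqrt_mult)
  finally show ?thesis .
qed

text \<open>One fixed \<open>S\<close> suffices, because the maximum over the class dominates each
  of its members.\<close>

lemma exact_risk_ge:
  assumes S: "S \<subseteq> {1..n}" "card S = k" "0 < k" and r: "0 < r" "r \<le> 1"
    and f: "squared_sum_based_test n f"
  shows "1 / sqrt (1 + r * (real k)\<^sup>2 / real n)
           \<le> measure (null_law n) {x \<in> space (null_law n). f x = 1}
             + measure (exact_law n S r) {x \<in> space (exact_law n S r). f x = 0}"
proof -
  obtain g where g: "g \<in> borel \<rightarrow>\<^sub>M count_space {0, 1}"
    and fg: "\<And>x. x \<in> space (\<Pi>\<^sub>M i\<in>{1..n}. borel :: real measure) \<Longrightarrow> f x = g (squared_sum n x)"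
    using f unfolding squared_sum_based_test_def by blast
  have [measurable]: "Measurable.pred borel (\<lambda>y. g y = a)" for a
    using measurable_compose[OF g, of "\<lambda>y. y = a" "count_space UNIV"] by simp
  have g01: "g y = 0 \<or> g y = 1" for y
    using measurable_space[OF g, of y] by auto
  define v where "v = real n - r * real k + r * (real k)\<^sup>2"
  define N where "N s = density lborel (normal_density 0 s)" for s
  define B where "B = {y::real. g (y\<^sup>2) = 0}"
  have B: "B \<in> sets borel"
    unfolding B_def by measurable
  have kn: "k \<le> n"
    using card_mono[OF _ S(1)] S(2) by simp
  then have n: "0 < n"
    using S by simp
  \<comment> \<open>From \<open>k \<ge> 1\<close> the alternative variance \<open>v\<close> is at
    least \<open>n\<close>, the order required by the density comparison.\<close>
  have "real k * 1 \<le> real k * real k"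
    using S(3) by (intro mult_left_mono) auto
  then have "r * real k \<le> r * (real k)\<^sup>2"
    using r by (simp add: power2_eq_square)
  then have vn: "real n \<le> v"
    by (simp add: v_def)
  then have v: "0 < v"
    using n by linarith
  interpret prob_space "N (sqrt (real n))"
    unfolding N_def using n by (intro prob_space_normal_density) simp
  have sp: "space (null_law n) = space (\<Pi>\<^sub>M i\<in>{1..n}. borel)"
    "space (exact_law n S r) = space (\<Pi>\<^sub>M i\<in>{1..n}. borel)"
    by (simp_all add: null_law_def exact_law_def)
  have "measure (null_law n) {x \<in> space (null_law n). f x = 1} = measure (N (sqrt (real n))) {y. g (y\<^sup>2) = 1}"
    using measure_squared_sum_null[OF n, of "\<lambda>y. g y = 1"] fg sp by (simp add: N_def cong: conj_cong)
  also have "{y. g (y\<^sup>2) = 1} = space (N (sqrt (real n))) - B"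
    using g01 by (force simp: B_def N_def)
  also have "measure (N (sqrt (real n))) \<dots> = 1 - measure (N (sqrt (real n))) B"
    using B by (intro prob_compl) (simp add: N_def)
  finally have null: "measure (null_law n) {x \<in> space (null_law n). f x = 1}
      = 1 - measure (N (sqrt (real n))) B" .
  have "measure (exact_law n S r) {x \<in> space (exact_law n S r). f x = 0} = measure (N (sqrt v)) B"
    using measure_squared_sum_exact[OF S(1) _ r(2) n, of "\<lambda>y. g y = 0" v] fg sp r v S(2)
    by (simp add: N_def B_def v_def cong: conj_cong)
  also have "\<dots> \<ge> sqrt (real n) / sqrt v * measure (N (sqrt (real n))) B"
    unfolding N_def using n vn B by (intro normal_measure_comparison) auto
  finally have alt: "sqrt (real n) / sqrt v * measure (N (sqrt (real n))) B
      \<le> measure (exact_law n S r) {x \<in> space (exact_law n S r). f x = 0}" .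
  define q where "q = sqrt (real n) / sqrt v"
  have "q \<le> 1"
    using vn v by (simp add: q_def)
  \<comment> \<open>With \<open>p\<close> the null probability of \<open>B\<close>, the risk is at
    least \<open>1 - p + q * p\<close>. Since \<open>p \<le> 1\<close> and \<open>q \<le> 1\<close>,
    this is at least \<open>q\<close>.\<close>
  then have "(1 - q) * measure (N (sqrt (real n))) B \<le> (1 - q) * 1"
    by (intro mult_left_mono) auto
  then have "q \<le> 1 - measure (N (sqrt (real n))) B + q * measure (N (sqrt (real n))) B"
    by (simp add: algebra_simps)
  moreover have "1 / sqrt (1 + r * (real k)\<^sup>2 / real n) \<le> q"
  proof -
    have "v / real n \<le> 1 + r * (real k)\<^sup>2 / real n"
      using n r by (simp add: v_def field_simps)
    then have "1 / sqrt (1 + r * (real k)\<^sup>2 / real n) \<le> 1 / sqrt (v / real n)"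
      using v n r by (intro divide_left_mono) (auto intro!: mult_pos_pos add_pos_nonneg)
    then show ?thesis
      by (simp add: q_def real_sqrt_divide)
  qed
  ultimately show ?thesis
    using null alt unfolding q_def by linarith
qed

section \<open>Suprema over the class and passage to the limit\<close>

lemma abs_cSUP_le:
  fixes f :: "'a \<Rightarrow> real"
  assumes "I \<noteq> {}" "\<And>x. x \<in> I \<Longrightarrow> \<bar>f x\<bar> \<le> c"
  shows "\<bar>SUP x\<in>I. f x\<bar> \<le> c"
  using assms by (intro cSup_abs_le) auto

theorem proposition3p1:
  fixes k :: "nat \<Rightarrow> nat" and \<rho> :: "nat \<Rightarrow> real" and \<C> :: "nat \<Rightarrow> nat set set"
  assumes k: "\<And>n. 2 \<le> n \<Longrightarrow> 2 \<le> k n \<and> k n \<le> n"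
    and \<rho>: "\<And>n. 2 \<le> n \<Longrightarrow> 0 < \<rho> n \<and> \<rho> n \<le> 1"
    and \<C>_nonempty: "\<And>n. 2 \<le> n \<Longrightarrow> \<C> n \<noteq> {}"
    and \<C>: "\<And>n S. 2 \<le> n \<Longrightarrow> S \<in> \<C> n \<Longrightarrow> S \<subseteq> {1..n} \<and> card S = k n"
  shows
    "(filterlim (\<lambda>n. \<rho> n * (real (k n))\<^sup>2 / real n) at_top sequentially \<longrightarrow>
       (\<forall>t :: nat \<Rightarrow> real.
          filterlim t at_top sequentially \<and> t \<in> o(\<lambda>n. \<rho> n * (real (k n))\<^sup>2 / real n) \<longrightarrow>
          (\<lambda>n. measure (null_law n) {x \<in> space (null_law n). squared_sum n x > real n * t n}
             + (SUP S\<in>\<C> n. SUP A\<in>general_model n S (\<rho> n).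
                  measure (gaussian n A)
                    {x \<in> space (gaussian n A). squared_sum n x \<le> real n * t n}))
            \<longlonglongrightarrow> 0))
     \<and>
     ((\<lambda>n. \<rho> n * (real (k n))\<^sup>2 / real n) \<longlonglongrightarrow> 0 \<longrightarrow>
       (\<forall>f :: nat \<Rightarrow> (nat \<Rightarrow> real) \<Rightarrow> nat.
          (\<forall>n\<ge>2. squared_sum_based_test n (f n)) \<longrightarrow>
          liminf (\<lambda>n. ereal
            (measure (null_law n) {x \<in> space (null_law n). f n x = 1}
             + (MAX S\<in>\<C> n. measure (exact_law n S (\<rho> n))
                  {x \<in> space (exact_law n S (\<rho> n)). f n x = 0}))) \<ge> 1))"
proof (intro conjI impI allI; (elim conjE)?)
  let ?s = "\<lambda>n. \<rho> n * (real (k n))\<^sup>2 / real n"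
  fix t :: "nat \<Rightarrow> real"
  assume t: "filterlim t at_top sequentially" and to: "t \<in> o(?s)"
  let ?risk = "\<lambda>n. measure (null_law n) {x \<in> space (null_law n). squared_sum n x > real n * t n}
      + (SUP S\<in>\<C> n. SUP A\<in>general_model n S (\<rho> n).
           measure (gaussian n A) {x \<in> space (gaussian n A). squared_sum n x \<le> real n * t n})"
  have "\<forall>\<^sub>F n in sequentially. norm (?risk n) \<le> 1 / t n + sqrt (t n / ?s n)"
    using eventually_ge_at_top[of 2] filterlim_at_top_dense[THEN iffD1, OF t, rule_format, of 0]
  proof eventually_elim
    case (elim n)
    have "\<bar>SUP S\<in>\<C> n. SUP A\<in>general_model n S (\<rho> n).
        measure (gaussian n A) {x \<in> space (gaussian n A). squared_sum n x \<le> real n * t n}\<bar>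
        \<le> sqrt (t n / ?s n)"
    \<comment> \<open>The rule is used twice, for the outer supremum over \<open>S\<close> and the
      inner one over \<open>A\<close>; each use requires a nonempty index set.\<close>
    proof (intro abs_cSUP_le)
      show "\<C> n \<noteq> {}"
        using \<C>_nonempty elim by simp
    next
      fix S assume "S \<in> \<C> n"
      then show "general_model n S (\<rho> n) \<noteq> {}"
        using exact_cov_in_general_model[of S n "\<rho> n"] \<C>[of n S] \<rho>[of n] elim by auto
    next
      fix S A assume "S \<in> \<C> n" "A \<in> general_model n S (\<rho> n)"
      then show "\<bar>measure (gaussian n A) {x \<in> space (gaussian n A). squared_sum n x \<le> real n * t n}\<bar>
          \<le> sqrt (t n / ?s n)"
        using general_acceptance_le[of A n S "\<rho> n" "k n" "t n"] \<C>[of n S] \<rho>[of n] k[of n] elim by simp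
    qed
    moreover have "measure (null_law n) {x \<in> space (null_law n). squared_sum n x > real n * t n} \<le> 1 / t n"
      using elim by (intro null_rejection_le) auto
    ultimately show ?case
      using measure_nonneg[of "null_law n" "{x \<in> space (null_law n). squared_sum n x > real n * t n}"]
      unfolding real_norm_def by linarith
  qed
  moreover have "(\<lambda>n. 1 / t n + sqrt (t n / ?s n)) \<longlonglongrightarrow> 0"
  proof -
    have "(\<lambda>n. 1 / t n) \<longlonglongrightarrow> 0"
      using t by (intro tendsto_divide_0[OF tendsto_const] filterlim_at_top_imp_at_infinity)
    moreover have "(\<lambda>n. sqrt (t n / ?s n)) \<longlonglongrightarrow> sqrt 0"
      using to by (intro tendsto_real_sqrt smalloD_tendsto)
    ultimately show ?thesis
      using tendsto_add by fastforce
  qed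
  ultimately show "?risk \<longlonglongrightarrow> 0"
    by (rule Lim_null_comparison)
next
  let ?s = "\<lambda>n. \<rho> n * (real (k n))\<^sup>2 / real n"
  fix f :: "nat \<Rightarrow> (nat \<Rightarrow> real) \<Rightarrow> nat"
  assume s: "?s \<longlonglongrightarrow> 0" and f: "\<forall>n\<ge>2. squared_sum_based_test n (f n)"
  let ?risk = "\<lambda>n. measure (null_law n) {x \<in> space (null_law n). f n x = 1}
      + (MAX S\<in>\<C> n. measure (exact_law n S (\<rho> n)) {x \<in> space (exact_law n S (\<rho> n)). f n x = 0})"
  have "(\<lambda>n. 1 / sqrt (1 + ?s n)) \<longlonglongrightarrow> 1 / sqrt (1 + 0)"
    using s by (intro tendsto_intros) simp_all
  then have "(\<lambda>n. ereal (1 / sqrt (1 + ?s n))) \<longlonglongrightarrow> 1"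
    by (simp add: one_ereal_def)
  then have "1 = liminf (\<lambda>n. ereal (1 / sqrt (1 + ?s n)))"
    by (intro lim_imp_Liminf[symmetric]) simp_all
  also have "\<dots> \<le> liminf (\<lambda>n. ereal (?risk n))"
  proof (rule Liminf_mono)
    show "\<forall>\<^sub>F n in sequentially. ereal (1 / sqrt (1 + ?s n)) \<le> ereal (?risk n)"
      using eventually_ge_at_top[of 2]
    proof eventually_elim
      case (elim n)
      obtain S where S: "S \<in> \<C> n"
        using \<C>_nonempty[OF elim] by blast
      \<comment> \<open>Finiteness of the class makes \<open>MAX\<close> an upper bound for its
        members.\<close>
      have "\<C> n \<subseteq> Pow {1..n}"
        using \<C>[OF elim] by blast
      then have "finite (\<C> n)"
        by (rule finite_subset) simp
      then have "measure (exact_law n S (\<rho> n)) {x \<in> space (exact_law n S (\<rho> n)). f n x = 0}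
          \<le> (MAX S\<in>\<C> n. measure (exact_law n S (\<rho> n)) {x \<in> space (exact_law n S (\<rho> n)). f n x = 0})"
        using S by (intro Max_ge) auto
      moreover have "1 / sqrt (1 + ?s n) \<le> measure (null_law n) {x \<in> space (null_law n). f n x = 1}
          + measure (exact_law n S (\<rho> n)) {x \<in> space (exact_law n S (\<rho> n)). f n x = 0}"
        using exact_risk_ge[of S n "k n" "\<rho> n" "f n"] \<C>[OF elim S] \<rho>[OF elim] k[OF elim] f elim by simp
      ultimately show ?case
        by simp
    qed
  qed
  finally show "liminf (\<lambda>n. ereal (?risk n)) \<ge> 1" .
qed

end
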